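(* Let $n\ge 1$, let $\alpha\in[1,2)$, let $A\in\mathbb{R}^{n\times n}$, and let $f(\lambda)=\lambda^n+a_1\lambda^{n-1}+\cdots+a_n$ be the characteristic polynomial of $A$. Let $H_\alpha$ be the $2n\times 2n$ fractional-order Routh-Hurwitz matrix of $f$, and for $p=1,\dots,n$ let $\nabla_p$ be the leading principal minor of $H_\alpha$ of order $2p$. Then the fractional-order linear time-invariant system $\mathrm{D}^{\alpha}x=Ax$ is asymptotically stable if and only if $\nabla_p>0$ for all $p=1,2,\dots,n$.
   Context: The system is $\mathrm{D}^{\alpha}x=Ax$ with state vector $x=(x_1,\dots,x_n)^T$, fractional order $\alpha\in[1,2)$ and real matrix $A$. Asymptotic stability is used through the known criterion of Matignon: the system is asymptotically stable if and only if every eigenvalue $\lambda_j\in\mathbb{C}$ of $A$ satisfies $|\arg(\lambda_j)|>\frac{\alpha\pi}{2}$, where $\arg$ is the principal argument in $(-\pi,\pi]$ (a zero eigenvalue is regarded as violating this condition). The fractional-order Routh-Hurwitz matrix: put $a_0=1$ and $a_j=0$ for $j<0$ or $j>n$. The $2n\times 2n$ matrix $H_\alpha$ of $f$ has, for $k=1,\dots,n$ and $q=1,\dots,2n$, the entries $$(H_\alpha)_{2k-1,q}=a_{q-k}\sin\left(\frac{(n-(q-k))\alpha\pi}{2}\right),\qquad (H_\alpha)_{2k,q}=a_{q-k}\cos\left(\frac{(n-(q-k))\alpha\pi}{2}\right).$$ Thus rows 1 and 2 are $\left(a_0\sin\frac{n\alpha\pi}{2},\,a_1\sin\frac{(n-1)\alpha\pi}{2},\dots,a_{n-1}\sin\frac{\alpha\pi}{2},0,\dots,0\right)$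 and $\left(a_0\cos\frac{n\alpha\pi}{2},\,a_1\cos\frac{(n-1)\alpha\pi}{2},\dots,a_{n-1}\cos\frac{\alpha\pi}{2},a_n,0,\dots,0\right)$, and each subsequent pair of rows is the preceding pair shifted one position to the right. *)

theory Defs
  imports Complex_Main "Jordan_Normal_Form.Char_Poly"
begin

text \<open>
  Asymptotic stability of the linear time-invariant system \<open>D\<^sup>\<alpha> x = A x\<close>, expressed by
  Matignon's criterion. Since \<^term>\<open>Arg 0 = 0\<close> in the library, \<^term>\<open>z \<noteq> 0\<close> already follows
  from the bound on the argument when \<^term>\<open>0 \<le> \<alpha>\<close>; it is stated so as not to depend on the
  value chosen for \<^term>\<open>Arg 0\<close>.
\<close>

definition asymptotically_stable :: "real \<Rightarrow> real mat \<Rightarrow> bool" where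
  "asymptotically_stable \<alpha> A \<longleftrightarrow>
     (\<forall>z::complex. eigenvalue (map_mat complex_of_real A) z \<longrightarrow>
        z \<noteq> 0 \<and> \<bar>Arg z\<bar> > \<alpha> * pi / 2)"

text \<open>
  For a polynomial \<open>f(x) = a\<^sub>0 x\<^sup>n + a\<^sub>1 x\<^bsup>n-1\<^esup> + \<dots> + a\<^sub>n\<close> of degree \<open>n\<close>, the coefficients
  numbered from the top, extended by zero to all integer indices.
\<close>

definition desc_coeff :: "real poly \<Rightarrow> int \<Rightarrow> real" where
  "desc_coeff f j = (if 0 \<le> j \<and> j \<le> int (degree f) then coeff f (degree f - nat j) else 0)"

text \<open>
  Matrix positions are counted from 0 here, so that the 1-based rows \<open>2k-1\<close> and \<open>2k\<close> are the
  rows \<open>i = 2(k-1)\<close> and \<open>i = 2(k-1)+1\<close>, and \<open>q - k = j - i div 2\<close> for the column \<open>j = q - 1\<close>.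
\<close>

definition frac_routh_hurwitz_mat :: "real \<Rightarrow> real poly \<Rightarrow> real mat" where
  "frac_routh_hurwitz_mat \<alpha> f =
     mat (2 * degree f) (2 * degree f)
       (\<lambda>(i, j). let d = int j - int (i div 2);
                     \<theta> = (real (degree f) - real_of_int d) * \<alpha> * pi / 2
                 in desc_coeff f d * (if even i then sin \<theta> else cos \<theta>))"

definition leading_principal_minor :: "'a::comm_ring_1 mat \<Rightarrow> nat \<Rightarrow> 'a" where
  "leading_principal_minor M r = det (mat r r (\<lambda>(i, j). M $$ (i, j)))"

end

theory Submission
  imports Defs
begin

text \<open>
  Put \<open>\<theta> = \<alpha> \<pi> / 2\<close> and \<open>P(w) = f(e\<^bsup>i\<theta>\<^esup> w)\<close>. As the spectrum of \<open>A\<close> is closed under conjugation,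
  stability means that all roots of \<open>P\<close> lie in the open upper half plane. By Hermite's theorem this
  holds iff the Bezoutian of the imaginary and the real part of \<open>P\<close> is positive definite: splitting
  off a root, \<open>P = (x - z) E\<close>, changes the Bezoutian form into
  \<open>Q\<^sub>P(v) = Im z \<bar>\<Sum> e\<^sub>i v\<^sub>i\<bar>\<^sup>2 + Q\<^sub>E(T v)\<close> with \<open>(T v)\<^sub>i = v\<^sub>i - cnj z v\<^bsub>i+1\<^esub>\<close>, and \<open>v\<^sub>i = cnj z\<^bsup>n-1-i\<^esup>\<close>
  spans the kernel of \<open>T\<close>. The minor \<open>\<nabla>\<^sub>p\<close> is the leading principal minor of order \<open>p\<close> of the
  Bezoutian, so Sylvester's criterion finishes the proof.
\<close>

section \<open>Bezoutian coefficients\<close>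

text \<open>Coefficients of (g(x) h(y) - h(x) g(y)) / (y - x), where g and h are the generating
  functions of \<open>Im (f l)\<close> and \<open>Re (f l)\<close>.\<close>

definition bez :: "(nat \<Rightarrow> complex) \<Rightarrow> nat \<Rightarrow> nat \<Rightarrow> real" where
  "bez f i j = (\<Sum>l\<le>i. Im (f l * cnj (f (i + j + 1 - l))))"

lemma bez_0: "bez f 0 j = Im (f 0 * cnj (f (Suc j)))"
  by (simp add: bez_def)

lemma bez_Suc: "bez f (Suc i) j = bez f i (Suc j) + Im (f (Suc i) * cnj (f (Suc j)))"
  by (simp add: bez_def)

text \<open>The reflection l -> i + j + 1 - l preserves \<open>{i<..j}\<close> and negates each
  summand, so the extra terms of the longer sum cancel.\<close>

lemma bez_sym: "bez f i j = bez f j i"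
proof -
  have *: "bez f i j = bez f j i" if "i \<le> j" for i j
  proof -
    define w where "w l = Im (f l * cnj (f (i + j + 1 - l)))" for l
    have "(\<Sum>l\<in>{i<..j}. w l) = (\<Sum>l\<in>{i<..j}. - w l)"
      by (rule sum.reindex_bij_witness[of _ "\<lambda>l. i + j + 1 - l" "\<lambda>l. i + j + 1 - l"])
        (auto simp: w_def algebra_simps)
    then have 0: "(\<Sum>l\<in>{i<..j}. w l) = 0"
      by (simp add: sum_negf)
    have "bez f j i = (\<Sum>l\<in>{..i} \<union> {i<..j}. w l)"
      using that by (auto simp: bez_def w_def add.commute intro!: sum.cong)
    also have "\<dots> = (\<Sum>l\<le>i. w l) + (\<Sum>l\<in>{i<..j}. w l)"
      by (rule sum.union_disjoint) auto
    finally show ?thesis using 0 by (simp add: bez_def w_def)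
  qed
  show ?thesis using *[of i j] *[of j i] by linarith
qed

text \<open>For j >= n the second index i + j + 1 - l exceeds n for all l <= i; symmetry covers i >=
  n.\<close>

lemma bez_eq_0:
  assumes "\<And>l. l > n \<Longrightarrow> f l = 0" and "i \<ge> n \<or> j \<ge> n"
  shows "bez f i j = 0"
proof -
  have *: "bez f i j = 0" if "j \<ge> n" for i j
    using that by (auto simp: bez_def assms(1) intro!: sum.neutral)
  show ?thesis using assms(2) *[of j i] *[of i j] bez_sym[of f i j] by auto
qed

section \<open>Splitting a linear factor off the Bezoutian\<close>

definition shift :: "(nat \<Rightarrow> 'a::zero) \<Rightarrow> nat \<Rightarrow> 'a" where
  "shift g i = (case i of 0 \<Rightarrow> 0 | Suc k \<Rightarrow> g k)"

lemma shift_simps [simp]: "shift g 0 = 0" "shift g (Suc i) = g i"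
  by (auto simp: shift_def)

text \<open>
  With generating functions \<open>e(x) = \<Sum> e\<^sub>i x\<^sup>i\<close>, the factor \<open>x - z\<close> becomes \<open>1 - z x\<close>, and the identity reads
  \<open>B\<^sub>f(x, y) = Im z e(x) e\<^sup>*(y) + (1 - cnj z x) (1 - z y) B\<^sub>e(x, y)\<close>.
\<close>

lemma bez_linear_factor:
  fixes e :: "nat \<Rightarrow> complex" and z :: complex
  assumes f: "\<And>i. f i = e i - z * shift e i"
  defines "U \<equiv> \<lambda>i j. complex_of_real (bez e i j) - cnj z * shift (\<lambda>i. complex_of_real (bez e i j)) i"
  shows "complex_of_real (bez f i j) =
    of_real (Im z) * e i * cnj (e j) + (U i j - z * shift (U i) j)"
proof -
  define w where "w i j = complex_of_real (Im (e i * cnj (e j)))" for i j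
  show ?thesis
  proof (induction i arbitrary: j)
    case 0
    show ?case
      by (cases j) (simp_all add: U_def bez_0 f complex_eq_iff algebra_simps)
  next
    case (Suc i)
    have r: "complex_of_real (bez e (Suc i) j) - of_real (bez e i (Suc j)) = w (Suc i) (Suc j)" for i j
      by (simp add: bez_Suc w_def)
    have b0: "complex_of_real (bez e i 0) = - w (Suc i) 0" for i
      by (simp add: bez_sym[of e i 0] bez_0 w_def)
    have r0: "complex_of_real (bez e 0 j) = w 0 (Suc j)" for j
      by (simp add: bez_0 w_def)
    \<comment> \<open>With W the generating function of \<open>w\<close>, \<open>U1\<close> and
      \<open>U2\<close> express (y - x) U(x, y) = (1 - cnj z x) W(x, y) at x^(i+1) y^(j+1) and at
      x^(i+1) y^j.\<close>
    have U1: "U (Suc i) j - U i (Suc j) = w (Suc i) (Suc j) - cnj z * w i (Suc j)" for i j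
    proof (cases i)
      case 0
      then show ?thesis using r[of 0 j] r0[of j] by (simp add: U_def algebra_simps)
    next
      case (Suc k)
      then show ?thesis using r[of i j] r[of k j] by (simp add: U_def algebra_simps)
    qed
    have U2: "shift (U (Suc i)) j - U i j = w (Suc i) j - cnj z * w i j"
    proof (cases j)
      case 0
      then show ?thesis by (cases i) (simp_all add: U_def b0 algebra_simps, simp add: w_def)
    next
      case (Suc k)
      then show ?thesis using U1[of i k] by simp
    qed
    have "complex_of_real (bez f (Suc i) j) = of_real (bez f i (Suc j)) + of_real (Im (f (Suc i) * cnj (f (Suc j))))"
      by (simp only: bez_Suc of_real_add)
    also have "\<dots> = of_real (Im z) * e i * cnj (e (Suc j)) + (U i (Suc j) - z * U i j)
        + of_real (Im (f (Suc i) * cnj (f (Suc j))))"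
      by (simp add: Suc.IH)
    \<comment> \<open>Coefficient of (1 - cnj z x) (1 - z y) W(x, y) plus (y - x) times the rank one
      term; by \<open>U1\<close> and \<open>U2\<close> the rest telescopes.\<close>
    also have "of_real (Im (f (Suc i) * cnj (f (Suc j)))) =
       of_real (Im z) * e (Suc i) * cnj (e j) - of_real (Im z) * e i * cnj (e (Suc j))
       + (w (Suc i) (Suc j) - cnj z * w i (Suc j)) - z * (w (Suc i) j - cnj z * w i j)"
      by (simp add: f w_def complex_eq_iff algebra_simps)
    finally show ?case by (simp add: U1[symmetric] U2[symmetric] algebra_simps)
  qed
qed

definition bez_form :: "nat \<Rightarrow> (nat \<Rightarrow> complex) \<Rightarrow> (nat \<Rightarrow> complex) \<Rightarrow> complex" where
  "bez_form n f v = (\<Sum>i<n. \<Sum>j<n. of_real (bez f i j) * v i * cnj (v j))"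

text \<open>Summation by parts: the shift moves from c to v, and \<open>c n = 0\<close> removes the
  boundary term.\<close>

lemma sum_shift_by_parts:
  fixes c v :: "nat \<Rightarrow> complex"
  assumes "c n = 0"
  shows "(\<Sum>i<Suc n. (c i - z * shift c i) * v i) = (\<Sum>i<n. c i * (v i - z * v (Suc i)))"
proof -
  have "(\<Sum>i<Suc n. shift c i * v i) = (\<Sum>i<n. c i * v (Suc i))"
    by (simp add: sum.lessThan_Suc_shift del: sum.lessThan_Suc)
  moreover have "(\<Sum>i<Suc n. (c i - z * shift c i) * v i) =
      (\<Sum>i<Suc n. c i * v i) - z * (\<Sum>i<Suc n. shift c i * v i)"
    unfolding sum_distrib_left sum_subtractf[symmetric] by (intro sum.cong refl) (simp add: algebra_simps)
  moreover have "(\<Sum>i<n. c i * (v i - z * v (Suc i))) =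
      (\<Sum>i<n. c i * v i) - z * (\<Sum>i<n. c i * v (Suc i))"
    unfolding sum_distrib_left sum_subtractf[symmetric] by (intro sum.cong refl) (simp add: algebra_simps)
  ultimately show ?thesis using assms by simp
qed

text \<open>Summation by parts in j moves the factor 1 - z y from the Bezoutian to the vector, then
  in i the factor 1 - cnj z x; both act there as T.\<close>

lemma bez_form_linear_factor:
  fixes e :: "nat \<Rightarrow> complex" and z :: complex
  assumes f: "\<And>i. f i = e i - z * shift e i" and e: "\<And>l. l > n \<Longrightarrow> e l = 0"
  shows "bez_form (Suc n) f v =
    of_real (Im z * (cmod (\<Sum>i<Suc n. e i * v i))\<^sup>2) + bez_form n e (\<lambda>i. v i - cnj z * v (Suc i))"
proof -
  define B where "B i j = complex_of_real (bez e i j)" for i j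
  define T where "T i = v i - cnj z * v (Suc i)" for i
  define U where "U i j = B i j - cnj z * shift (\<lambda>i. B i j) i" for i j
  have B0: "B i j = 0" if "i \<ge> n \<or> j \<ge> n" for i j
    using bez_eq_0[of n e] e that by (auto simp: B_def)
  have U0: "U i n = 0" for i
    by (cases i) (simp_all add: U_def B0)
  have "bez_form (Suc n) f v =
    (\<Sum>i<Suc n. \<Sum>j<Suc n. of_real (Im z) * (e i * v i) * cnj (e j * v j))
    + (\<Sum>i<Suc n. \<Sum>j<Suc n. (U i j - z * shift (U i) j) * v i * cnj (v j))"
    unfolding bez_form_def sum.distrib[symmetric]
    by (intro sum.cong refl, subst bez_linear_factor[OF f])
      (simp add: U_def[abs_def] B_def[abs_def] algebra_simps)
  also have "(\<Sum>i<Suc n. \<Sum>j<Suc n. of_real (Im z) * (e i * v i) * cnj (e j * v j)) =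
     of_real (Im z) * ((\<Sum>i<Suc n. e i * v i) * cnj (\<Sum>i<Suc n. e i * v i))"
    unfolding cnj_sum by (simp only: sum_product, simp only: sum_distrib_left mult.assoc)
  also have "\<dots> = of_real (Im z * (cmod (\<Sum>i<Suc n. e i * v i))\<^sup>2)"
    by (simp only: complex_norm_square[symmetric] of_real_mult of_real_power)
  also have "(\<Sum>i<Suc n. \<Sum>j<Suc n. (U i j - z * shift (U i) j) * v i * cnj (v j)) =
    (\<Sum>i<Suc n. v i * (\<Sum>j<Suc n. (U i j - z * shift (U i) j) * cnj (v j)))"
    unfolding sum_distrib_left by (intro sum.cong refl) (simp add: algebra_simps)
  also have "\<dots> = (\<Sum>i<Suc n. v i * (\<Sum>j<n. U i j * cnj (T j)))"
    by (subst sum_shift_by_parts) (simp_all add: U0 T_def)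
  also have "\<dots> = (\<Sum>i<Suc n. \<Sum>j<n. v i * (U i j * cnj (T j)))"
    unfolding sum_distrib_left ..
  also have "\<dots> = (\<Sum>j<n. \<Sum>i<Suc n. v i * (U i j * cnj (T j)))"
    by (rule sum.swap)
  also have "\<dots> = (\<Sum>j<n. cnj (T j) * (\<Sum>i<Suc n. U i j * v i))"
    unfolding sum_distrib_left by (intro sum.cong refl) (simp add: algebra_simps)
  also have "\<dots> = (\<Sum>j<n. cnj (T j) * (\<Sum>i<n. B i j * T i))"
    unfolding U_def by (subst sum_shift_by_parts) (simp_all add: B0 T_def)
  also have "\<dots> = (\<Sum>j<n. \<Sum>i<n. B i j * T i * cnj (T j))"
    unfolding sum_distrib_left by (intro sum.cong refl) (simp add: algebra_simps)
  also have "\<dots> = bez_form n e T"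
    unfolding bez_form_def B_def by (rule sum.swap)
  finally show ?thesis unfolding T_def .
qed

section \<open>Positive definiteness of real symmetric forms\<close>

text \<open>Induction through the Schur complement \<open>s\<close> of \<open>m 0 0\<close>: each
  leading minor of m is \<open>m 0 0\<close> times one of s, and s is the form left after completing
  the square in \<open>v 0\<close>.\<close>

lemma sylvester_criterion:
  fixes m :: "nat \<Rightarrow> nat \<Rightarrow> real"
  assumes "\<And>i j. m i j = m j i"
  shows "(\<forall>p\<in>{1..n}. det (mat p p (\<lambda>(i, j). m i j)) > 0) \<longleftrightarrow>
    (\<forall>v. (\<exists>i<n. v i \<noteq> 0) \<longrightarrow> (\<Sum>i<n. \<Sum>j<n. m i j * v i * v j) > 0)"
  using assms
proof (induction n arbitrary: m)
  case 0
  then show ?case by simp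
next
  case (Suc n m)
  define s where "s i j = m (Suc i) (Suc j) - m (Suc i) 0 * m 0 (Suc j) / m 0 0" for i j
  have s_sym: "s i j = s j i" for i j
    using Suc.prems by (simp add: s_def)
  have det1: "det (mat (Suc 0) (Suc 0) (\<lambda>(i, j). m i j)) = m 0 0"
    by (subst det_single) auto
  have det_Suc: "det (mat (Suc p) (Suc p) (\<lambda>(i, j). m i j)) = m 0 0 * det (mat p p (\<lambda>(i, j). s i j))"
    if "m 0 0 \<noteq> 0" for p
  proof -
    \<comment> \<open>Block LU factorisation with \<open>L\<close> unit lower triangular.\<close>
    define L where "L = four_block_mat (1\<^sub>m 1) (0\<^sub>m 1 p) (mat p 1 (\<lambda>(i, j). m (Suc i) 0 / m 0 0)) (1\<^sub>m p)"
    define R where "R = four_block_mat (mat 1 1 (\<lambda>(i, j). m 0 0)) (mat 1 p (\<lambda>(i, j). m 0 (Suc j)))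
      (0\<^sub>m p 1) (mat p p (\<lambda>(i, j). s i j))"
    have c: "L \<in> carrier_mat (1 + p) (1 + p)" "R \<in> carrier_mat (1 + p) (1 + p)"
      unfolding L_def R_def by (rule four_block_carrier_mat; simp)+
    have "mat (Suc p) (Suc p) (\<lambda>(i, j). m i j) = L * R"
      unfolding L_def R_def
      by (subst mult_four_block_mat[of _ 1 1 _ p _ p _ _ 1 _ p])
        (auto simp: scalar_prod_def s_def that intro!: eq_matI)
    also have "det \<dots> = det L * det R"
      by (rule det_mult[OF c])
    also have "det L = 1"
      unfolding L_def by (subst det_four_block_mat_upper_right_zero[of _ 1 _ p]) auto
    also have "det R = det (mat 1 1 (\<lambda>(i, j). m 0 0)) * det (mat p p (\<lambda>(i, j). s i j))"
      unfolding R_def by (subst det_four_block_mat_lower_left_zero[of _ 1 _ p]) auto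
    also have "det (mat 1 1 (\<lambda>(i, j). m 0 0)) = m 0 0"
      by (subst det_single) auto
    finally show ?thesis by simp
  qed
  have form_Suc: "(\<Sum>i<Suc n. \<Sum>j<Suc n. m i j * v i * v j) =
      m 0 0 * (v 0 + (\<Sum>j<n. m 0 (Suc j) * v (Suc j)) / m 0 0)\<^sup>2
      + (\<Sum>i<n. \<Sum>j<n. s i j * v (Suc i) * v (Suc j))"
    if "m 0 0 \<noteq> 0" for v
  proof -
    define S where "S = (\<Sum>j<n. m 0 (Suc j) * v (Suc j))"
    have S': "(\<Sum>i<n. m (Suc i) 0 * v (Suc i)) = S"
      using Suc.prems unfolding S_def by metis
    have "(\<Sum>i<Suc n. \<Sum>j<Suc n. m i j * v i * v j) =
      m 0 0 * v 0 * v 0 + v 0 * S + v 0 * (\<Sum>i<n. m (Suc i) 0 * v (Suc i))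
       + (\<Sum>i<n. \<Sum>j<n. m (Suc i) (Suc j) * v (Suc i) * v (Suc j))"
      by (simp add: sum.lessThan_Suc_shift sum.distrib S_def sum_distrib_left algebra_simps
          del: sum.lessThan_Suc)
    moreover have "(\<Sum>i<n. \<Sum>j<n. m (Suc i) (Suc j) * v (Suc i) * v (Suc j)) =
       (\<Sum>i<n. \<Sum>j<n. s i j * v (Suc i) * v (Suc j)) + (\<Sum>i<n. m (Suc i) 0 * v (Suc i)) * S / m 0 0"
      unfolding S_def sum_product sum_divide_distrib sum.distrib[symmetric]
      by (intro sum.cong refl) (simp add: s_def algebra_simps)
    ultimately show ?thesis unfolding S' S_def[symmetric] using that
      by (simp add: field_simps power2_eq_square)
  qed
  show ?case
  proof (cases "m 0 0 > 0")
    case True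
    have "(\<forall>p\<in>{1..Suc n}. det (mat p p (\<lambda>(i, j). m i j)) > 0) \<longleftrightarrow>
      (\<forall>p\<in>{1..n}. det (mat p p (\<lambda>(i, j). s i j)) > 0)"
      (is "?M \<longleftrightarrow> ?N")
    proof
      assume M: ?M
      show ?N
      proof
        fix p assume "p \<in> {1..n}"
        then have "det (mat (Suc p) (Suc p) (\<lambda>(i, j). m i j)) > 0" using M by simp
        then show "det (mat p p (\<lambda>(i, j). s i j)) > 0"
          using True det_Suc[of p] by (simp add: zero_less_mult_iff)
      qed
    next
      assume N: ?N
      show ?M
      proof
        fix p assume p: "p \<in> {1..Suc n}"
        then obtain q where q: "p = Suc q" "q \<le> n" by (cases p) auto
        \<comment> \<open>For q = 0 this is the empty determinant, equal to 1.\<close>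
        have "det (mat q q (\<lambda>(i, j). s i j)) > 0"
          using N q by (cases "q = 0") auto
        then show "det (mat p p (\<lambda>(i, j). m i j)) > 0"
          using True det_Suc[of q] q by simp
      qed
    qed
    also have "\<dots> \<longleftrightarrow> (\<forall>v. (\<exists>i<n. v i \<noteq> 0) \<longrightarrow> (\<Sum>i<n. \<Sum>j<n. s i j * v i * v j) > 0)"
      by (rule Suc.IH[OF s_sym])
    also have "\<dots> \<longleftrightarrow> (\<forall>v. (\<exists>i<Suc n. v i \<noteq> 0) \<longrightarrow> (\<Sum>i<Suc n. \<Sum>j<Suc n. m i j * v i * v j) > 0)"
      (is "?P \<longleftrightarrow> ?Q")
    proof
      assume P: ?P
      show ?Q
      proof (intro allI impI)
        fix v :: "nat \<Rightarrow> real" assume v: "\<exists>i<Suc n. v i \<noteq> 0"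
        show "(\<Sum>i<Suc n. \<Sum>j<Suc n. m i j * v i * v j) > 0"
        proof (cases "\<exists>i<n. v (Suc i) \<noteq> 0")
          case t: True
          then have "(\<Sum>i<n. \<Sum>j<n. s i j * v (Suc i) * v (Suc j)) > 0"
            using P[rule_format, of "\<lambda>i. v (Suc i)"] by simp
          then show ?thesis using True by (subst form_Suc) (simp_all add: add_nonneg_pos)
        next
          case False
          with v have "v 0 \<noteq> 0" by (metis less_Suc_eq_0_disj)
          with False show ?thesis using True by (subst form_Suc) simp_all
        qed
      qed
    next
      assume Q: ?Q
      show ?P
      proof (intro allI impI)
        fix u :: "nat \<Rightarrow> real" assume u: "\<exists>i<n. u i \<noteq> 0"
        \<comment> \<open>The first entry is chosen to make the square in \<open>form_Suc\<close>
          vanish.\<close>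
        define v where "v i = (case i of 0 \<Rightarrow> - (\<Sum>j<n. m 0 (Suc j) * u j) / m 0 0 | Suc k \<Rightarrow> u k)" for i
        have "\<exists>i<Suc n. v i \<noteq> 0" using u by (metis Suc_less_eq nat.case(2) v_def)
        then have "(\<Sum>i<Suc n. \<Sum>j<Suc n. m i j * v i * v j) > 0" using Q by blast
        then show "(\<Sum>i<n. \<Sum>j<n. s i j * u i * u j) > 0"
          using True by (subst (asm) form_Suc) (simp_all add: v_def)
      qed
    qed
    finally show ?thesis .
  next
    case False
    have neg: "\<not> (\<forall>p\<in>{1..Suc n}. det (mat p p (\<lambda>(i, j). m i j)) > 0)"
      using False det1 by (auto intro!: bexI[of _ "Suc 0"])
    \<comment> \<open>On the first unit vector the form takes the value \<open>m 0 0\<close>, so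
      both sides fail.\<close>
    define v where "v i = (if i = 0 then 1 else 0 :: real)" for i :: nat
    have "(\<Sum>i<Suc n. \<Sum>j<Suc n. m i j * v i * v j) = m 0 0"
      by (simp add: sum.lessThan_Suc_shift v_def del: sum.lessThan_Suc)
    moreover have "\<exists>i<Suc n. v i \<noteq> 0" by (auto simp: v_def)
    ultimately have "\<not> (\<forall>v. (\<exists>i<Suc n. v i \<noteq> 0) \<longrightarrow>
        (\<Sum>i<Suc n. \<Sum>j<Suc n. m i j * v i * v j) > 0)"
      using False by (intro notI, drule_tac x = v in spec) simp
    then show ?thesis using neg by blast
  qed
qed

lemma Re_bez_form:
  "Re (bez_form n f v) = (\<Sum>i<n. \<Sum>j<n. bez f i j * Re (v i) * Re (v j))
    + (\<Sum>i<n. \<Sum>j<n. bez f i j * Im (v i) * Im (v j))"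
  by (simp add: bez_form_def Re_sum sum.distrib[symmetric] algebra_simps)

text \<open>As \<open>bez\<close> is real, the form at v is the sum of its values at Re v and Im v.
  This links the complex vectors of Hermite's argument to Sylvester's criterion.\<close>

lemma bez_form_pos_iff_real:
  "(\<forall>v. (\<exists>i<n. v i \<noteq> 0) \<longrightarrow> Re (bez_form n f v) > 0) \<longleftrightarrow>
   (\<forall>v. (\<exists>i<n. v i \<noteq> 0) \<longrightarrow> (\<Sum>i<n. \<Sum>j<n. bez f i j * v i * v j) > 0)"
  (is "?C \<longleftrightarrow> ?R")
proof
  assume C: ?C
  show ?R
  proof (intro allI impI)
    fix v :: "nat \<Rightarrow> real" assume "\<exists>i<n. v i \<noteq> 0"
    then show "(\<Sum>i<n. \<Sum>j<n. bez f i j * v i * v j) > 0"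
      using C[rule_format, of "\<lambda>i. complex_of_real (v i)"] by (simp add: Re_bez_form)
  qed
next
  assume R: ?R
  show ?C
  proof (intro allI impI)
    fix v :: "nat \<Rightarrow> complex" assume v: "\<exists>i<n. v i \<noteq> 0"
    let ?Q = "\<lambda>u. \<Sum>i<n. \<Sum>j<n. bez f i j * u i * u j"
    have nonneg: "?Q u \<ge> 0" for u
    proof (cases "\<exists>i<n. u i \<noteq> 0")
      case True
      then show ?thesis using R by (meson less_imp_le)
    qed simp
    from v consider "\<exists>i<n. Re (v i) \<noteq> 0" | "\<exists>i<n. Im (v i) \<noteq> 0"
      by (auto simp: complex_eq_iff)
    then show "Re (bez_form n f v) > 0"
      using R[rule_format, of "\<lambda>i. Re (v i)"] R[rule_format, of "\<lambda>i. Im (v i)"]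
        nonneg[of "\<lambda>i. Re (v i)"] nonneg[of "\<lambda>i. Im (v i)"]
      unfolding Re_bez_form by cases (auto intro: add_pos_nonneg add_nonneg_pos)
  qed
qed

section \<open>Hermite's theorem on roots in the upper half plane\<close>

text \<open>Coefficients of the reversed polynomial, for which the factor x - z becomes the 1 - z x
  of \<open>bez_linear_factor\<close>.\<close>

definition descending_coeff :: "complex poly \<Rightarrow> nat \<Rightarrow> complex" where
  "descending_coeff P i = (if i \<le> degree P then coeff P (degree P - i) else 0)"

lemma descending_coeff_linear_factor:
  assumes "E \<noteq> 0"
  shows "descending_coeff ([:- z, 1:] * E) i = descending_coeff E i - z * shift (descending_coeff E) i"
proof -
  have d: "degree ([:- z, 1:] * E) = Suc (degree E)"
    using assms by (subst degree_mult_eq) auto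
  have c: "coeff ([:- z, 1:] * E) k = shift (coeff E) k - z * coeff E k" for k
    by (cases k) auto
  show ?thesis
    unfolding descending_coeff_def d c
    by (cases i; cases "degree E - (i - 1)")
      (auto simp: descending_coeff_def coeff_eq_0 Suc_diff_le diff_Suc split: nat.splits)
qed

text \<open>Identifies the linear form in \<open>bez_form_linear_factor\<close>, on a geometric
  vector, with evaluation of E.\<close>

lemma sum_descending_coeff:
  "(\<Sum>i<Suc (degree E). descending_coeff E i * x ^ (degree E - i)) = poly E x"
  unfolding poly_altdef
  by (rule sum.reindex_bij_witness[of _ "\<lambda>i. degree E - i" "\<lambda>i. degree E - i"])
    (auto simp: descending_coeff_def)

text \<open>Induction on the degree: if T v is nonzero, the form of the cofactor is positive;
  otherwise v is geometric and the square is positive.\<close>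

lemma roots_upper_half_plane_imp_bez_form_pos:
  assumes "degree P = n" "P \<noteq> 0" "\<And>z. poly P z = 0 \<Longrightarrow> Im z > 0" "\<exists>i<n. v i \<noteq> 0"
  shows "Re (bez_form n (descending_coeff P) v) > 0"
  using assms
proof (induction n arbitrary: P v)
  case 0
  then show ?case by simp
next
  case (Suc n P v)
  have "\<not> constant (poly P)" using Suc.prems(1) by (simp add: constant_degree)
  then obtain z where z: "poly P z = 0" using fundamental_theorem_of_algebra by blast
  then obtain E where P: "P = [:- z, 1:] * E" unfolding poly_eq_0_iff_dvd by (auto elim: dvdE)
  have E: "E \<noteq> 0" using Suc.prems(2) P by auto
  have n: "degree E = n" using Suc.prems(1) E unfolding P by (subst (asm) degree_mult_eq) auto
  have Imz: "Im z > 0" using Suc.prems(3) z by blast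
  have E_roots: "Im w > 0" if "poly E w = 0" for w
    using Suc.prems(3)[of w] that unfolding P by simp
  define T where "T i = v i - cnj z * v (Suc i)" for i
  define S where "S = (\<Sum>i<Suc n. descending_coeff E i * v i)"
  have form: "bez_form (Suc n) (descending_coeff P) v =
      of_real (Im z * (cmod S)\<^sup>2) + bez_form n (descending_coeff E) T"
    unfolding S_def T_def
    by (rule bez_form_linear_factor)
      (simp_all only: P descending_coeff_linear_factor[OF E], simp add: descending_coeff_def n)
  show ?case
  proof (cases "\<exists>i<n. T i \<noteq> 0")
    case True
    then have "Re (bez_form n (descending_coeff E) T) > 0"
      using Suc.IH n E E_roots by blast
    then show ?thesis using Imz unfolding form by (simp add: add_nonneg_pos)
  next
    case False
    \<comment> \<open>\<open>T i = 0\<close> is a recursion that determines v from its last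
      entry.\<close>
    have v: "v (n - k) = cnj z ^ k * v n" if "k \<le> n" for k
      using that
    proof (induction k)
      case (Suc k)
      then have "T (n - Suc k) = 0" using False by auto
      then show ?case using Suc by (simp add: T_def Suc_diff_Suc)
    qed simp
    have v': "v i = v n * cnj z ^ (n - i)" if "i \<le> n" for i
      using v[of "n - i"] that by simp
    have "v n \<noteq> 0" using Suc.prems(4) v' by (metis less_Suc_eq_le mult_zero_left)
    moreover have "S = v n * poly E (cnj z)"
      unfolding S_def sum_descending_coeff[symmetric] n sum_distrib_left
      by (intro sum.cong refl, subst v') auto
    \<comment> \<open>\<open>cnj z\<close> lies in the lower half plane, where E has no
      root.\<close>
    moreover have "poly E (cnj z) \<noteq> 0" using E_roots[of "cnj z"] Imz by auto
    moreover have "bez_form n (descending_coeff E) T = 0"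
      using False by (simp add: bez_form_def)
    ultimately show ?thesis using Imz unfolding form by simp
  qed
qed

text \<open>On the kernel of T only the square remains, and its sign is that of
  \<open>Im z\<close>.\<close>

lemma bez_form_pos_imp_roots_upper_half_plane:
  assumes "P \<noteq> 0"
    and pos: "\<And>v. \<exists>i<degree P. v i \<noteq> 0 \<Longrightarrow> Re (bez_form (degree P) (descending_coeff P) v) > 0"
    and z: "poly P z = 0"
  shows "Im z > 0"
proof -
  obtain E where P: "P = [:- z, 1:] * E"
    using z unfolding poly_eq_0_iff_dvd by (auto elim: dvdE)
  have E: "E \<noteq> 0" using assms(1) P by auto
  define n where "n = degree E"
  have n: "degree P = Suc n" using E unfolding P n_def by (subst degree_mult_eq) auto
  define v where "v i = cnj z ^ (n - i)" for i
  have T: "v i - cnj z * v (Suc i) = 0" if "i < n" for i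
    using that by (simp add: v_def Suc_diff_Suc flip: power_Suc)
  have form: "bez_form (Suc n) (descending_coeff P) v =
      of_real (Im z * (cmod (\<Sum>i<Suc n. descending_coeff E i * v i))\<^sup>2)
        + bez_form n (descending_coeff E) (\<lambda>i. v i - cnj z * v (Suc i))"
    by (rule bez_form_linear_factor)
      (simp_all only: P descending_coeff_linear_factor[OF E], simp add: descending_coeff_def n_def)
  have "bez_form n (descending_coeff E) (\<lambda>i. v i - cnj z * v (Suc i)) = 0"
    unfolding bez_form_def by (intro sum.neutral ballI) (simp add: T)
  \<comment> \<open>The last entry of v is \<open>cnj z ^ 0 = 1\<close>, so v is nonzero even for z
    = 0.\<close>
  moreover have "Re (bez_form (Suc n) (descending_coeff P) v) > 0"
    using pos[of v] n by (auto simp: v_def intro!: exI[of _ n])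
  ultimately show ?thesis unfolding form
    by (simp add: zero_less_mult_iff)
qed

section \<open>Hurwitz determinants as minors of the Bezoutian\<close>

text \<open>Transposing and then swapping the block rows brings the commuting blocks to the bottom
  row, as \<open>det_four_block_mat\<close> requires.\<close>

lemma det_four_block_mat_commute_left:
  fixes A :: "'a :: idom mat"
  assumes [simp]: "A \<in> carrier_mat n n" "B \<in> carrier_mat n n" "C \<in> carrier_mat n n" "D \<in> carrier_mat n n"
    and AC: "A * C = C * A"
  shows "det (four_block_mat A B C D) = det (A * D - C * B)"
proof -
  let ?M = "four_block_mat A B C D"
  have M: "?M \<in> carrier_mat (n + n) (n + n)" by simp
  note [simp] = assms(1-4)[THEN carrier_matD(1)] assms(1-4)[THEN carrier_matD(2)]
  have "det ?M = det (transpose_mat ?M)" by (rule det_transpose[OF M, symmetric])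
  also have "transpose_mat ?M = four_block_mat (transpose_mat A) (transpose_mat C) (transpose_mat B) (transpose_mat D)"
    by (rule transpose_four_block_mat[of _ n n _ n _ n]) simp_all
  also have "det \<dots> = (-1) ^ (n * n) *
      det (four_block_mat (transpose_mat B) (transpose_mat D) (transpose_mat A) (transpose_mat C))"
    by (subst det_swap_initial_rows[of _ "n + n" n n])
      (auto intro!: arg_cong[of _ _ det] eq_matI)
  also have "det (four_block_mat (transpose_mat B) (transpose_mat D) (transpose_mat A) (transpose_mat C)) =
      det (transpose_mat B * transpose_mat C - transpose_mat D * transpose_mat A)"
    by (rule det_four_block_mat[of _ n]) (simp_all add: AC flip: transpose_mult[of _ n n _ n])
  also have "transpose_mat B * transpose_mat C - transpose_mat D * transpose_mat A =
      (-1) \<cdot>\<^sub>m transpose_mat (A * D - C * B)"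
    by (subst (1 2) transpose_mult[of _ n n _ n, symmetric]) (auto intro!: eq_matI)
  also have "det \<dots> = (-1) ^ n * det (A * D - C * B)"
    by (subst det_smult, subst det_transpose[of _ n]) auto
  \<comment> \<open>The signs cancel because n * n and n have the same parity.\<close>
  also have "(-1) ^ (n * n) * ((-1) ^ n * det (A * D - C * B)) = det (A * D - C * B)"
    by (cases "even n") auto
  finally show ?thesis .
qed

text \<open>The Hurwitz pattern without trigonometry; in the application \<open>f d\<close> is a_d
  cis ((n - d) \<theta>). The guard stands for a negative index, which natural subtraction would
  truncate to 0.\<close>

definition hurwitz_entry :: "(nat \<Rightarrow> complex) \<Rightarrow> nat \<Rightarrow> nat \<Rightarrow> real" where
  "hurwitz_entry f i j =
    (if j < i div 2 then 0 else if even i then Im (f (j - i div 2)) else Re (f (j - i div 2)))"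

text \<open>
  Lists the first \<open>m\<close> even rows in reverse order, then the first \<open>m\<close> odd rows. Because of the
  reversal this permutation is even: going from \<open>m\<close> to \<open>m + 1\<close> moves one row past \<open>2 m\<close> others.
\<close>

definition unshuffle :: "nat \<Rightarrow> nat \<Rightarrow> nat" where
  "unshuffle m i = (if i < m then 2 * (m - 1 - i) else if i < 2 * m then 2 * (i - m) + 1 else i)"

lemma det_unshuffle_rows:
  assumes "2 * m \<le> N"
  shows "det (mat N N (\<lambda>(i, j). h (unshuffle m i) j)) = det (mat N N (\<lambda>(i, j). h i j))"
  using assms
proof (induction m)
  case 0
  then show ?case by (simp add: unshuffle_def)
next
  case (Suc m)
  have "det (mat N N (\<lambda>(i, j). h (unshuffle m i) j)) =
      det (mat N N (\<lambda>(i, j). h (unshuffle (Suc m) i) j))"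
    using Suc.prems
    by (subst det_swap_initial_rows[of _ N "2 * m" 1])
      (auto simp: unshuffle_def intro!: arg_cong[of _ _ det] eq_matI arg_cong2[of _ _ _ _ h])
  then show ?case using Suc by simp
qed

text \<open>Unshuffling the rows leaves four Toeplitz blocks, the upper two with reversed rows. The
  left ones commute up to that reversal, so the determinant collapses to order p.\<close>

lemma det_hurwitz:
  "det (mat (2 * p) (2 * p) (\<lambda>(i, j). hurwitz_entry f i j)) = det (mat p p (\<lambda>(i, j). bez f i j))"
proof -
  define toep where "toep g s = mat p p (\<lambda>(i, k). if s + k < i then 0 else g (f (s + k - i)) :: real)"
    for g :: "complex \<Rightarrow> real" and s
  define J where "J = mat p p (\<lambda>(i, k). if k = p - 1 - i then 1 else 0 :: real)"
  have [simp]: "toep g s \<in> carrier_mat p p" "dim_row (toep g s) = p" "dim_col (toep g s) = p" for g s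
    by (simp_all add: toep_def)
  have [simp]: "J \<in> carrier_mat p p" "dim_row J = p" "dim_col J = p" by (simp_all add: J_def)
  have J_mult: "J * X = mat p p (\<lambda>(i, j). X $$ (p - 1 - i, j))" if "X \<in> carrier_mat p p" for X
    using that by (auto simp: J_def scalar_prod_def if_distrib[of "\<lambda>x. x * _"] sum.delta cong: if_cong intro!: eq_matI)
  have toep_mult: "(toep g 0 * toep h s) $$ (i, j) = (\<Sum>l<p - i. g (f l) * (if s + j < i + l then 0 else h (f (s + j - (i + l)))))"
    if "i < p" "j < p" for g h s i j
  proof -
    have "(toep g 0 * toep h s) $$ (i, j) =
        (\<Sum>k<p. (if k < i then 0 else g (f (k - i))) * (if s + j < k then 0 else h (f (s + j - k))))"
      using that by (simp add: scalar_prod_def toep_def lessThan_atLeast0 cong: if_cong)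
    also have "\<dots> = (\<Sum>k\<in>{i..<p}. g (f (k - i)) * (if s + j < k then 0 else h (f (s + j - k))))"
      by (rule sum.mono_neutral_cong_right) auto
    also have "\<dots> = (\<Sum>l<p - i. g (f l) * (if s + j < i + l then 0 else h (f (s + j - (i + l)))))"
      by (rule sum.reindex_bij_witness[of _ "\<lambda>l. i + l" "\<lambda>k. k - i"]) auto
    finally show ?thesis .
  qed
  \<comment> \<open>Upper triangular Toeplitz matrices multiply like truncated power series.\<close>
  have comm: "toep Im 0 * toep Re 0 = toep Re 0 * toep Im 0"
  proof (rule eq_matI)
    fix i j assume "i < dim_row (toep Re 0 * toep Im 0)" "j < dim_col (toep Re 0 * toep Im 0)"
    then have ij: "i < p" "j < p" by simp_all
    have *: "(toep g 0 * toep h 0) $$ (i, j) = (if j < i then 0 else \<Sum>l\<le>j - i. g (f l) * h (f (j - i - l)))" for g h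
    proof (cases "j < i")
      case True
      then show ?thesis unfolding toep_mult[OF ij] by (auto intro!: sum.neutral)
    next
      case False
      have "(\<Sum>l<p - i. g (f l) * (if 0 + j < i + l then 0 else h (f (0 + j - (i + l))))) =
          (\<Sum>l\<le>j - i. g (f l) * h (f (j - i - l)))"
        using ij False by (intro sum.mono_neutral_cong_right) auto
      then show ?thesis using False unfolding toep_mult[OF ij] by simp
    qed
    have "(\<Sum>l\<le>j - i. Im (f l) * Re (f (j - i - l))) = (\<Sum>l\<le>j - i. Re (f l) * Im (f (j - i - l)))"
      by (rule sum.reindex_bij_witness[of _ "\<lambda>l. j - i - l" "\<lambda>l. j - i - l"])
        (auto simp del: diff_diff_left)
    then show "(toep Im 0 * toep Re 0) $$ (i, j) = (toep Re 0 * toep Im 0) $$ (i, j)"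
      unfolding * by (simp only:)
  qed simp_all
  let ?K = "toep Im 0 * toep Re p - toep Re 0 * toep Im p"
  have K: "?K \<in> carrier_mat p p"
    by (intro minus_carrier_mat mult_carrier_mat[of _ p p]) simp_all
  have "det (mat (2 * p) (2 * p) (\<lambda>(i, j). hurwitz_entry f i j)) =
      det (mat (2 * p) (2 * p) (\<lambda>(i, j). hurwitz_entry f (unshuffle p i) j))"
    by (rule det_unshuffle_rows[symmetric]) simp
  also have "mat (2 * p) (2 * p) (\<lambda>(i, j). hurwitz_entry f (unshuffle p i) j) =
      four_block_mat (J * toep Im 0) (J * toep Im p) (toep Re 0) (toep Re p)"
    unfolding J_mult[OF \<open>\<And>g s. toep g s \<in> carrier_mat p p\<close>]
    by (rule eq_matI) (auto simp: hurwitz_entry_def unshuffle_def toep_def)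
  also have "\<dots> = four_block_mat J (0\<^sub>m p p) (0\<^sub>m p p) (1\<^sub>m p)
      * four_block_mat (toep Im 0) (toep Im p) (toep Re 0) (toep Re p)"
    by (subst mult_four_block_mat[of _ p p _ p _ p _ _ p _ p])
      (simp_all add: right_add_zero_mat[OF mult_carrier_mat[of _ p p _ p]])
  also have "det \<dots> = det (four_block_mat J (0\<^sub>m p p) (0\<^sub>m p p) (1\<^sub>m p))
      * det (four_block_mat (toep Im 0) (toep Im p) (toep Re 0) (toep Re p))"
    by (rule det_mult[of _ "p + p"]) simp_all
  also have "det (four_block_mat J (0\<^sub>m p p) (0\<^sub>m p p) (1\<^sub>m p)) = det J"
    by (subst det_four_block_mat_upper_right_zero[of _ p _ p]) simp_all
  also have "det (four_block_mat (toep Im 0) (toep Im p) (toep Re 0) (toep Re p)) = det ?K"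
    by (rule det_four_block_mat_commute_left[of _ p, OF _ _ _ _ comm]) simp_all
  also have "det J * det ?K = det (J * ?K)"
    by (rule det_mult[symmetric, of _ p]) auto
  \<comment> \<open>Row p - 1 - i of the products sums over l <= i, exactly the range in
    \<open>bez f i j\<close>.\<close>
  also have "J * ?K = mat p p (\<lambda>(i, j). bez f i j)"
  proof (subst J_mult[OF K], rule eq_matI)
    fix i j assume "i < dim_row (mat p p (\<lambda>(i, j). bez f i j))" "j < dim_col (mat p p (\<lambda>(i, j). bez f i j))"
    then have ij: "i < p" "j < p" "p - 1 - i < p" by simp_all
    have idx: "p + j - (p - 1 - i + l) = i + j + 1 - l" if "l \<le> i" for l
      using ij that by simp
    have pi: "{..<p - (p - 1 - i)} = {..i}" using ij by auto
    have "?K $$ (p - 1 - i, j) =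
        (toep Im 0 * toep Re p) $$ (p - 1 - i, j) - (toep Re 0 * toep Im p) $$ (p - 1 - i, j)"
      using ij by simp
    also have "\<dots> = bez f i j"
      unfolding toep_mult[OF ij(3,2)] bez_def sum_subtractf[symmetric] pi
      using ij by (intro sum.cong refl) (auto simp only: idx atMost_iff split: if_splits, auto)
    finally have "?K $$ (p - 1 - i, j) = bez f i j" .
    then show "mat p p (\<lambda>(i, j). ?K $$ (p - 1 - i, j)) $$ (i, j) = mat p p (\<lambda>(i, j). bez f i j) $$ (i, j)"
      using ij by simp
  qed simp_all
  finally show ?thesis .
qed

lemma roots_upper_half_plane_iff_hurwitz:
  assumes "P \<noteq> 0"
  shows "(\<forall>z. poly P z = 0 \<longrightarrow> Im z > 0) \<longleftrightarrow>
    (\<forall>p\<in>{1..degree P}. det (mat (2 * p) (2 * p) (\<lambda>(i, j). hurwitz_entry (descending_coeff P) i j)) > 0)"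
proof -
  have "(\<forall>z. poly P z = 0 \<longrightarrow> Im z > 0) \<longleftrightarrow>
    (\<forall>v. (\<exists>i<degree P. v i \<noteq> 0) \<longrightarrow> Re (bez_form (degree P) (descending_coeff P) v) > 0)"
    using roots_upper_half_plane_imp_bez_form_pos[OF refl assms]
      bez_form_pos_imp_roots_upper_half_plane[OF assms] by blast
  also have "\<dots> \<longleftrightarrow> (\<forall>p\<in>{1..degree P}. det (mat p p (\<lambda>(i, j). bez (descending_coeff P) i j)) > 0)"
    unfolding bez_form_pos_iff_real by (rule sylvester_criterion[OF bez_sym, symmetric])
  finally show ?thesis unfolding det_hurwitz .
qed

section \<open>From the stability sector to the upper half plane\<close>

text \<open>For \<theta> >= \<pi>/2 the sector is convex, hence the intersection of a rotated half
  plane with its mirror image in the real axis.\<close>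

lemma abs_Arg_gt_iff:
  assumes "pi / 2 \<le> \<theta>" "\<theta> < pi"
  shows "z \<noteq> 0 \<and> \<bar>Arg z\<bar> > \<theta> \<longleftrightarrow> Im (cis (- \<theta>) * z) > 0 \<and> Im (cis (- \<theta>) * cnj z) > 0"
proof (cases "z = 0")
  case False
  define \<phi> where "\<phi> = Arg z"
  have z: "z = of_real (cmod z) * cis \<phi>"
    using rcis_cmod_Arg[of z] by (simp add: rcis_def \<phi>_def)
  have "cis (- \<theta>) * z = of_real (cmod z) * cis (\<phi> - \<theta>)"
    by (subst z) (simp add: cis_mult)
  then have 1: "Im (cis (- \<theta>) * z) > 0 \<longleftrightarrow> sin (\<phi> - \<theta>) > 0"
    using False by (simp add: zero_less_mult_iff)
  have "cis (- \<theta>) * cnj z = of_real (cmod z) * cis (- \<phi> - \<theta>)"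
    by (subst z) (simp add: cis_mult cis_cnj minus_diff_commute)
  then have 2: "Im (cis (- \<theta>) * cnj z) > 0 \<longleftrightarrow> sin (- \<phi> - \<theta>) > 0"
    using False by (simp add: zero_less_mult_iff)
  \<comment> \<open>Changing the sign of \<phi> swaps the two conditions.\<close>
  have "sin (\<phi> - \<theta>) > 0 \<and> sin (- \<phi> - \<theta>) > 0 \<longleftrightarrow> sin (\<bar>\<phi>\<bar> - \<theta>) > 0 \<and> sin (- \<bar>\<phi>\<bar> - \<theta>) > 0"
    by (cases "\<phi> \<ge> 0") auto
  also have "\<dots> \<longleftrightarrow> \<bar>\<phi>\<bar> > \<theta>"
  proof
    assume gt: "\<bar>\<phi>\<bar> > \<theta>"
    have le: "\<bar>\<phi>\<bar> \<le> pi" using Arg_bounded[of z] by (auto simp: \<phi>_def)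
    have "sin (\<bar>\<phi>\<bar> - \<theta>) > 0" by (rule sin_gt_zero) (use gt le assms pi_gt_zero in linarith)+
    \<comment> \<open>\<theta> >= \<pi>/2 gives \<bar>\<phi>\<bar> + \<theta> > \<pi>, so the angle
      raised by 2 \<pi> lies in (0, \<pi>).\<close>
    moreover have "sin (- \<bar>\<phi>\<bar> - \<theta> + 2 * pi) > 0"
      by (rule sin_gt_zero) (use gt le assms in linarith)+
    ultimately show "sin (\<bar>\<phi>\<bar> - \<theta>) > 0 \<and> sin (- \<bar>\<phi>\<bar> - \<theta>) > 0" by (simp only: sin_periodic)
  next
    assume "sin (\<bar>\<phi>\<bar> - \<theta>) > 0 \<and> sin (- \<bar>\<phi>\<bar> - \<theta>) > 0"
    moreover have "sin (\<theta> - \<bar>\<phi>\<bar>) \<ge> 0" if "\<bar>\<phi>\<bar> \<le> \<theta>"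
      by (rule sin_ge_zero) (use that assms in linarith)+
    moreover have "sin (\<bar>\<phi>\<bar> - \<theta>) = - sin (\<theta> - \<bar>\<phi>\<bar>)"
      by (metis minus_diff_eq sin_minus)
    ultimately show "\<bar>\<phi>\<bar> > \<theta>" by linarith
  qed
  finally show ?thesis using False 1 2 by (simp add: \<phi>_def)
qed simp

theorem theorem1:
  fixes n :: nat and \<alpha> :: real and A :: "real mat"
  assumes "n \<ge> 1"
    and "1 \<le> \<alpha>" and "\<alpha> < 2"
    and "A \<in> carrier_mat n n"
  shows "asymptotically_stable \<alpha> A \<longleftrightarrow>
    (\<forall>p\<in>{1..n}. leading_principal_minor (frac_routh_hurwitz_mat \<alpha> (char_poly A)) (2 * p) > 0)"
proof -
  define \<theta> where "\<theta> = \<alpha> * pi / 2"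
  have \<theta>: "pi / 2 \<le> \<theta>" "\<theta> < pi"
    using assms(2,3) by (auto simp: \<theta>_def)
  define f where "f = char_poly A"
  define q where "q = map_poly complex_of_real f"
  define P where "P = pcompose q [:0, cis \<theta>:]"
  have deg_f: "degree f = n" and f0: "f \<noteq> 0"
    using degree_monic_char_poly[OF assms(4)] by (auto simp: f_def)
  have coeff_P: "coeff P k = cis \<theta> ^ k * of_real (coeff f k)" for k
    by (simp add: P_def q_def coeff_pcompose_linear coeff_map_poly)
  have deg_P: "degree P = n"
    by (simp add: P_def q_def degree_pcompose deg_f)
  have P0: "P \<noteq> 0"
    using coeff_P[of n] f0 deg_f by auto
  have poly_P: "poly P z = poly q (cis \<theta> * z)" for z
    by (simp add: P_def poly_pcompose mult.commute)
  have poly_cnj: "poly q (cnj z) = cnj (poly q z)" for z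
    by (simp add: q_def poly_altdef coeff_map_poly)
  have rot: "cis \<theta> * (cis (- \<theta>) * z) = z" "cis (- \<theta>) * (cis \<theta> * z) = z" for z
    by (simp_all add: cis_mult flip: mult.assoc)
  have "eigenvalue (map_mat complex_of_real A) z \<longleftrightarrow> poly q z = 0" for z
    using assms(4)
    by (simp add: eigenvalue_root_char_poly[of _ n] q_def f_def of_real_hom.char_poly_hom[of _ n])
  then have "asymptotically_stable \<alpha> A \<longleftrightarrow> (\<forall>z. poly q z = 0 \<longrightarrow> z \<noteq> 0 \<and> \<bar>Arg z\<bar> > \<theta>)"
    by (simp add: asymptotically_stable_def \<theta>_def)
  \<comment> \<open>The condition on \<open>cnj z\<close> is the first condition at the conjugate
    root, since q has real coefficients.\<close>
  also have "\<dots> \<longleftrightarrow> (\<forall>z. poly q z = 0 \<longrightarrow> Im (cis (- \<theta>) * z) > 0)"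
    unfolding abs_Arg_gt_iff[OF \<theta>] by (metis poly_cnj complex_cnj_zero)
  also have "\<dots> \<longleftrightarrow> (\<forall>z. poly P z = 0 \<longrightarrow> Im z > 0)"
    unfolding poly_P by (metis rot)
  also have "\<dots> \<longleftrightarrow> (\<forall>p\<in>{1..n}. det (mat (2 * p) (2 * p)
      (\<lambda>(i, j). hurwitz_entry (descending_coeff P) i j)) > 0)"
    unfolding roots_upper_half_plane_iff_hurwitz[OF P0] deg_P ..
  also have "\<dots> \<longleftrightarrow>
    (\<forall>p\<in>{1..n}. leading_principal_minor (frac_routh_hurwitz_mat \<alpha> (char_poly A)) (2 * p) > 0)"
  proof (rule ball_cong[OF refl])
    fix p assume p: "p \<in> {1..n}"
    have entry: "frac_routh_hurwitz_mat \<alpha> f $$ (i, j) = hurwitz_entry (descending_coeff P) i j"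
      if "i < 2 * n" "j < 2 * n" for i j
    \<comment> \<open>Outside 0 <= d <= n both entries are 0; inside, the imaginary and real parts
      of a_d cis ((n - d) \<theta>) give the sine and cosine rows.\<close>
    proof (cases "j < i div 2 \<or> j - i div 2 > n")
      case True
      then show ?thesis using that
        by (auto simp: frac_routh_hurwitz_mat_def deg_f Let_def desc_coeff_def hurwitz_entry_def
            descending_coeff_def deg_P)
    next
      case False
      define d where "d = j - i div 2"
      have d: "int j - int (i div 2) = int d" "d \<le> n" "\<not> j < i div 2"
        using False by (auto simp: d_def)
      have "descending_coeff P d = of_real (coeff f (n - d)) * cis ((real n - real d) * \<alpha> * pi / 2)"
        using d by (simp add: descending_coeff_def deg_P coeff_P DeMoivre \<theta>_def mult.assoc of_nat_diff)
      then show ?thesis using that d(2,3)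
        by (simp add: frac_routh_hurwitz_mat_def deg_f Let_def d(1) desc_coeff_def hurwitz_entry_def
            flip: d_def)
    qed
    have "mat (2 * p) (2 * p) (\<lambda>(i, j). hurwitz_entry (descending_coeff P) i j) =
        mat (2 * p) (2 * p) (\<lambda>(i, j). frac_routh_hurwitz_mat \<alpha> f $$ (i, j))"
      using p by (intro eq_matI) (simp_all add: entry)
    then show "det (mat (2 * p) (2 * p) (\<lambda>(i, j). hurwitz_entry (descending_coeff P) i j)) > 0 \<longleftrightarrow>
        leading_principal_minor (frac_routh_hurwitz_mat \<alpha> (char_poly A)) (2 * p) > 0"
      by (simp add: leading_principal_minor_def f_def)
  qed
  finally show ?thesis .
qed

end
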